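(* Let $p_n$ ($n\ge 0$) be the polynomials in $\mathbb{Z}[N]$ determined by $p_0=p_1=p_2=1$ and $p_{n+3}\,p_n=p_{n+2}^2+p_{n+1}^2+N-3$ for $n\ge 0$. Then the following hold. (i) For each integer $N\ge 3$, the triples $(p_n(N),p_{n+1}(N),p_{n+2}(N))$, $n\ge 0$, are pairwise distinct integer solutions $(x,y,z)$ of the Diophantine equation $$x^2+y^2+z^2-Nxyz+J=0\qquad\text{with } J=N-3.$$ (ii) For each integer $N\ge 3$, the logarithmic height $h(p_n(N))$ grows exponentially with $n$. (iii) For all real $N>2$, $$\lim_{n\to\infty}\frac{\log\log p_n(N)}{n}=\log\lambda,\qquad \lambda=\frac{1+\sqrt5}{2}.$$
   Context: The recurrence $p_{n+3}p_n=p_{n+2}^2+p_{n+1}^2+N-3$ is understood in the field $\mathbb{Q}(N)$, with $N$ an indeterminate; it does generate elements of $\mathbb{Z}[N]$. It is the case $J=N-3$, with initial data $(1,1,1)$, of the recurrence $\tau_{n+3}\tau_n=\tau_{n+2}^2+\tau_{n+1}^2+J$. For real $N>2$ one has $p_n(N)>1$ for all $n\ge 3$, so $\log\log p_n(N)$ is defined for $n\ge 3$. For a rational number $x=p/q$ in lowest terms, the height is $H(x)=\max\{|p|,|q|\}$ and the logarithmic height is $h(x)=\log H(x)$; thus $h(m)=\log|m|$ for a nonzero integer $m$. "Grows exponentially with $n$" means that there are constants $c,C>0$ and $\mu,\nu>1$ (possibly depending on $N$) with $c\mu^n\le h(p_n(N))\le C\nu^n$ for all sufficiently large $n$. *)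

theory Defs
  imports Complex_Main "HOL-Computational_Algebra.Computational_Algebra"
begin

definition satisfies_tau_recurrence :: "'a::comm_ring_1 \<Rightarrow> (nat \<Rightarrow> 'a) \<Rightarrow> bool" where
  "satisfies_tau_recurrence J \<tau> \<longleftrightarrow>
     (\<forall>n. \<tau> (n + 3) * \<tau> n = \<tau> (n + 2) ^ 2 + \<tau> (n + 1) ^ 2 + J)"

text \<open>The field $\mathbb{Q}(N)$ is \<^typ>\<open>rat poly fract\<close>.\<close>

definition QN_var :: "rat poly fract" where
  "QN_var = to_fract [:0, 1:]"

definition int_poly_to_QN :: "int poly \<Rightarrow> rat poly fract" where
  "int_poly_to_QN f = to_fract (map_poly rat_of_int f)"

definition is_p_sequence_QN :: "(nat \<Rightarrow> rat poly fract) \<Rightarrow> bool" where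
  "is_p_sequence_QN q \<longleftrightarrow>
     q 0 = 1 \<and> q 1 = 1 \<and> q 2 = 1 \<and> satisfies_tau_recurrence (QN_var - 3) q"

text \<open>The result of \<^const>\<open>quotient_of\<close> is coprime with positive denominator.\<close>

definition height :: "rat \<Rightarrow> int" where
  "height x = (case quotient_of x of (a, b) \<Rightarrow> max \<bar>a\<bar> \<bar>b\<bar>)"

definition log_height :: "rat \<Rightarrow> real" where
  "log_height x = ln (real_of_int (height x))"

definition grows_exponentially :: "(nat \<Rightarrow> real) \<Rightarrow> bool" where
  "grows_exponentially f \<longleftrightarrow>
     (\<exists>c C \<mu> \<nu>. c > 0 \<and> C > 0 \<and> \<mu> > 1 \<and> \<nu> > 1 \<and>
        (\<forall>\<^sub>F n in sequentially. c * \<mu> ^ n \<le> f n \<and> f n \<le> C * \<nu> ^ n))"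

end

theory Submission imports Defs begin

text \<open>
  The nonlinear recurrence hides Vieta jumping on the surface
  \<open>x\<^sup>2 + y\<^sup>2 + z\<^sup>2 - N x y z + (N - 3) = 0\<close>. Fix \<open>y\<close> and \<open>z\<close>: the two roots \<open>x, x'\<close> of this quadratic
  satisfy \<open>x + x' = N y z\<close> and \<open>x x' = y\<^sup>2 + z\<^sup>2 + (N - 3)\<close>. The product formula is the given recurrence;
  the sum formula \<open>p\<^bsub>n+3\<^esub> = N p\<^bsub>n+2\<^esub> p\<^bsub>n+1\<^esub> - p\<^bsub>n\<^esub>\<close> involves no division, so it produces elements of
  \<open>\<int>[N]\<close>. Since \<open>(1,1,1)\<close> lies on the surface, the sum formula keeps the whole orbit on it
  (\<open>vieta_orbit_on_surface\<close>), and the product formula follows (\<open>vieta_orbit_tau_recurrence\<close>).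
  Conversely, the product formula determines the sequence as long as no term vanishes, and no
  \<open>p\<^bsub>n\<^esub>\<close> is the zero polynomial because its value at \<open>3\<close> is at least \<open>1\<close>.

  For real \<open>N > 2\<close> the orbit increases strictly from index \<open>2\<close> on (\<open>vieta_orbit_growth\<close>), which makes the
  triples distinct. Then the subtracted term \<open>p\<^bsub>n\<^esub>\<close> is harmless:
  \<open>(N - 1) p\<^bsub>n+2\<^esub> p\<^bsub>n+1\<^esub> \<le> p\<^bsub>n+3\<^esub> \<le> N p\<^bsub>n+2\<^esub> p\<^bsub>n+1\<^esub>\<close>. Hence \<open>log p\<^bsub>n\<^esub>\<close> obeys the
  Fibonacci recurrence up to a bounded nonnegative error and lies between two positive multiples of
  \<open>\<lambda>\<^sup>n\<close> for \<open>n \<ge> 3\<close>, where \<open>\<lambda>\<close> is the golden ratio (\<open>ln_vieta_orbit_bounds\<close>). Both growth claims follow, the height of a positive integer being the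
  integer itself.
\<close>

section \<open>Vieta orbits over a commutative ring\<close>

definition vieta_orbit :: "'a::comm_ring_1 \<Rightarrow> (nat \<Rightarrow> 'a) \<Rightarrow> bool" where
  "vieta_orbit N a \<longleftrightarrow> a 0 = 1 \<and> a 1 = 1 \<and> a 2 = 1 \<and>
     (\<forall>n. a (n + 3) = N * a (n + 2) * a (n + 1) - a n)"

lemma vieta_orbit_step:
  "vieta_orbit N a \<Longrightarrow> a (n + 3) = N * a (n + 2) * a (n + 1) - a n"
  by (simp add: vieta_orbit_def)

lemma vieta_orbit_hom:
  assumes "vieta_orbit N a"
    and "h 1 = 1" "\<And>x y. h (x * y) = h x * h y" "\<And>x y. h (x - y) = h x - h y"
  shows "vieta_orbit (h N) (\<lambda>n. h (a n))"
  using assms by (simp add: vieta_orbit_def)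

text \<open>Replacing one root of the quadratic in \<open>x\<close> by the other does not change the value of the
  quadratic, so the left-hand side is constant along the orbit.\<close>

lemma vieta_orbit_on_surface:
  assumes "vieta_orbit N a"
  shows "a n ^ 2 + a (n + 1) ^ 2 + a (n + 2) ^ 2 - N * a n * a (n + 1) * a (n + 2) + (N - 3) = 0"
proof (induction n)
  case 0
  then show ?case using assms by (simp add: vieta_orbit_def numeral_2_eq_2)
next
  case (Suc n)
  have "a (n + 1) ^ 2 + a (n + 2) ^ 2 + a (n + 3) ^ 2
        - N * a (n + 1) * a (n + 2) * a (n + 3) + (N - 3)
      = a n ^ 2 + a (n + 1) ^ 2 + a (n + 2) ^ 2 - N * a n * a (n + 1) * a (n + 2) + (N - 3)"
    unfolding vieta_orbit_step[OF assms] by (simp add: algebra_simps power2_eq_square)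
  with Suc show ?case by (simp add: eval_nat_numeral)
qed

lemma vieta_orbit_tau_recurrence:
  assumes "vieta_orbit N a"
  shows "satisfies_tau_recurrence (N - 3) a"
  unfolding satisfies_tau_recurrence_def
proof
  fix n
  have "a (n + 3) * a n - (a (n + 2) ^ 2 + a (n + 1) ^ 2 + (N - 3))
      = - (a n ^ 2 + a (n + 1) ^ 2 + a (n + 2) ^ 2 - N * a n * a (n + 1) * a (n + 2) + (N - 3))"
    unfolding vieta_orbit_step[OF assms] by (simp add: algebra_simps power2_eq_square)
  then show "a (n + 3) * a n = a (n + 2) ^ 2 + a (n + 1) ^ 2 + (N - 3)"
    unfolding vieta_orbit_on_surface[OF assms] by simp
qed

text \<open>The product form of the recurrence only determines the next term after division by the term
  three places before it, hence the hypothesis that one solution has no zeros.\<close>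

lemma tau_recurrence_unique:
  fixes a b :: "nat \<Rightarrow> 'a::idom"
  assumes a: "satisfies_tau_recurrence J a" and b: "satisfies_tau_recurrence J b"
    and init: "a 0 = b 0" "a 1 = b 1" "a 2 = b 2" and nz: "\<And>n. b n \<noteq> 0"
  shows "a = b"
proof -
  have "a n = b n \<and> a (n + 1) = b (n + 1) \<and> a (n + 2) = b (n + 2)" for n
  proof (induction n)
    case 0
    then show ?case using init by (simp add: numeral_2_eq_2)
  next
    case (Suc n)
    have "a (n + 3) * a n = b (n + 3) * b n"
      using a b Suc unfolding satisfies_tau_recurrence_def by metis
    then have "a (n + 3) = b (n + 3)" using Suc nz[of n] by simp
    then show ?case using Suc by (simp add: eval_nat_numeral)
  qed
  then show ?thesis by blast
qed

section \<open>Growth of real Vieta orbits\<close>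

text \<open>Positivity is not visible from the sum formula, because of its minus sign. Carrying monotonicity
  along repairs this: from \<open>a n \<le> a (n + 2) \<le> a (n + 2) * a (n + 1)\<close> the subtraction costs at most one of the
  \<open>N\<close> copies of that product, and \<open>N - 1 > 1\<close>.\<close>

lemma vieta_orbit_growth:
  fixes N :: real
  assumes "N > 2" and orbit: "vieta_orbit N a"
  shows "1 \<le> a n \<and> a n \<le> a (n + 1) \<and> a (n + 1) \<le> a (n + 2) \<and> a (n + 2) < a (n + 3) \<and>
    (N - 1) * a (n + 2) * a (n + 1) \<le> a (n + 3) \<and> a (n + 3) \<le> N * a (n + 2) * a (n + 1)"
proof -
  have step: "a (n + 2) < a (n + 3) \<and>
      (N - 1) * a (n + 2) * a (n + 1) \<le> a (n + 3) \<and> a (n + 3) \<le> N * a (n + 2) * a (n + 1)"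
    if "1 \<le> a n" "a n \<le> a (n + 1)" "a (n + 1) \<le> a (n + 2)" for n
  proof -
    have prod: "a (n + 2) \<le> a (n + 2) * a (n + 1)"
      using that by (simp add: mult_le_cancel_left1)
    have rec: "a (n + 3) = (N - 1) * (a (n + 2) * a (n + 1)) + (a (n + 2) * a (n + 1) - a n)"
      by (simp add: vieta_orbit_step[OF orbit] algebra_simps)
    have "1 * (a (n + 2) * a (n + 1)) < (N - 1) * (a (n + 2) * a (n + 1))"
      using \<open>N > 2\<close> that prod by (intro mult_strict_right_mono) auto
    then show ?thesis
      using rec prod that vieta_orbit_step[OF orbit, of n] unfolding mult.assoc by linarith
  qed
  have "1 \<le> a n \<and> a n \<le> a (n + 1) \<and> a (n + 1) \<le> a (n + 2)"
  proof (induction n)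
    case 0
    then show ?case using orbit by (simp add: vieta_orbit_def numeral_2_eq_2)
  next
    case (Suc n)
    then show ?case using step[of n] by (simp add: eval_nat_numeral)
  qed
  then show ?thesis using step by blast
qed

lemma vieta_orbit_strict_mono:
  fixes N :: real
  assumes "N > 2" and "vieta_orbit N a"
  shows "strict_mono (\<lambda>n. a (n + 2))"
  using vieta_orbit_growth[OF assms] by (simp add: strict_mono_Suc_iff eval_nat_numeral)

lemma vieta_orbit_gt_1:
  fixes N :: real
  assumes "N > 2" and "vieta_orbit N a" and "n \<ge> 3"
  shows "a n > 1"
proof -
  have "a (0 + 2) < a (n - 2 + 2)"
    using \<open>n \<ge> 3\<close> by (intro strict_monoD[OF vieta_orbit_strict_mono[OF assms(1,2)]]) simp
  moreover have "n - 2 + 2 = n" using \<open>n \<ge> 3\<close> by simp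
  ultimately show ?thesis using assms(2) by (simp add: vieta_orbit_def numeral_2_eq_2)
qed

definition golden :: real where
  "golden = (1 + sqrt 5) / 2"

lemma golden_gt_1: "golden > 1"
  by (simp add: golden_def)

lemma golden_power_rec: "golden ^ (n + 2) = golden ^ (n + 1) + golden ^ n"
proof -
  have "golden ^ 2 = golden + 1"
    by (simp add: golden_def power2_eq_square field_simps)
  then show ?thesis
    by (simp only: power_add) (simp add: algebra_simps)
qed

text \<open>Comparison with multiples of the Fibonacci solution \<open>\<lambda>\<^sup>n\<close>, started at an arbitrary index since
  the logarithm of a Vieta orbit vanishes up to index \<open>2\<close>.\<close>

lemma super_fibonacci_ge:
  fixes b :: "nat \<Rightarrow> real"
  assumes "c * golden ^ k \<le> b k" "c * golden ^ (k + 1) \<le> b (k + 1)"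
    and rec: "\<And>n. n \<ge> k \<Longrightarrow> b (n + 1) + b n \<le> b (n + 2)"
  shows "n \<ge> k \<Longrightarrow> c * golden ^ n \<le> b n"
proof -
  have "c * golden ^ (k + m) \<le> b (k + m) \<and> c * golden ^ (k + m + 1) \<le> b (k + m + 1)" for m
  proof (induction m)
    case 0
    then show ?case using assms(1,2) by simp
  next
    case (Suc m)
    have "c * golden ^ (k + m + 2) = c * golden ^ (k + m + 1) + c * golden ^ (k + m)"
      by (simp only: golden_power_rec distrib_left)
    also have "\<dots> \<le> b (k + m + 2)"
      using Suc rec[of "k + m"] by linarith
    finally show ?case using Suc by simp
  qed
  then show "n \<ge> k \<Longrightarrow> c * golden ^ n \<le> b n"
    using le_iff_add[of k n] by blast
qed

lemma ln_vieta_orbit_bounds: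
  fixes N :: real
  assumes "N > 2" and orbit: "vieta_orbit N a"
  obtains c C where "c > 0" "C > 0"
    "\<And>n. n \<ge> 3 \<Longrightarrow> c * golden ^ n \<le> ln (a n) \<and> ln (a n) \<le> C * golden ^ n"
proof -
  have ge1: "1 \<le> a n" for n
    using vieta_orbit_growth[OF assms, of n] by simp
  have pos: "a n > 0" for n
    using ge1[of n] by linarith
  have lower: "ln (a (n + 2)) + ln (a (n + 1)) \<le> ln (a (n + 3))" for n
  proof -
    have "1 * (a (n + 2) * a (n + 1)) \<le> (N - 1) * (a (n + 2) * a (n + 1))"
      using \<open>N > 2\<close> pos[of "n + 1"] pos[of "n + 2"] by (intro mult_right_mono) auto
    then have "a (n + 2) * a (n + 1) \<le> a (n + 3)"
      using vieta_orbit_growth[OF assms, of n] unfolding mult.assoc by linarith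
    then have "ln (a (n + 2) * a (n + 1)) \<le> ln (a (n + 3))"
      using pos by (intro ln_mono mult_pos_pos)
    then show ?thesis
      using pos[of "n + 1"] pos[of "n + 2"] by (simp add: ln_mult)
  qed
  have upper: "ln (a (n + 3)) \<le> ln N + ln (a (n + 2)) + ln (a (n + 1))" for n
  proof -
    have "ln (a (n + 3)) \<le> ln (N * a (n + 2) * a (n + 1))"
      using vieta_orbit_growth[OF assms, of n] pos[of "n + 3"] by (intro ln_mono) auto
    then show ?thesis
      using pos[of "n + 1"] pos[of "n + 2"] \<open>N > 2\<close> by (simp add: ln_mult)
  qed
  \<comment> \<open>Dividing by the fourth power serves both starting values \<open>ln (a 3)\<close> and \<open>ln (a 4)\<close>, the latter being
    the larger one.\<close>
  define c where "c = ln (a 3) / golden ^ 4"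
  define C where "C = ln N"
  have gp: "golden ^ 4 > 0" "golden ^ 3 \<le> golden ^ 4"
    using golden_gt_1 by (simp_all add: power_increasing)
  have "ln (a 3) > 0"
    using vieta_orbit_gt_1[OF assms, of 3] by simp
  then have "c > 0"
    using gp unfolding c_def by (intro divide_pos_pos)
  have c4: "c * golden ^ 4 = ln (a 3)"
    using gp(1) unfolding c_def by simp
  have "c * golden ^ 3 \<le> c * golden ^ 4"
    using gp(2) \<open>c > 0\<close> by (intro mult_left_mono) auto
  then have c3: "c * golden ^ 3 \<le> ln (a 3)"
    using c4 by simp
  have "a 3 \<le> a 4"
    using vieta_orbit_growth[OF assms, of 3] by (simp add: eval_nat_numeral)
  then have ln34: "ln (a 3) \<le> ln (a 4)"
    using pos[of 3] by simp
  have lo: "c * golden ^ n \<le> ln (a n)" if "n \<ge> 3" for n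
  proof (rule super_fibonacci_ge[where k = 3 and b = "\<lambda>n. ln (a n)"])
    show "ln (a (n + 1)) + ln (a n) \<le> ln (a (n + 2))" if "n \<ge> 3" for n
      using lower[of "n - 1"] that by (simp add: eval_nat_numeral)
  qed (use c3 c4 ln34 that in simp_all)
  \<comment> \<open>Adding \<open>ln N\<close> absorbs the error term and turns the upper estimate into the exact Fibonacci
    inequality; negation makes it a lower estimate.\<close>
  have up: "- C * golden ^ n \<le> - (ln (a n) + ln N)" if "n \<ge> 1" for n
  proof (rule super_fibonacci_ge[where k = 1 and b = "\<lambda>n. - (ln (a n) + ln N)"])
    have "a 1 = 1" "a 2 = 1" using orbit by (auto simp: vieta_orbit_def)
    moreover have "1 \<le> golden ^ 1" "1 \<le> golden ^ (1 + 1)"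
      using golden_gt_1 one_le_power[of golden] by (simp_all del: power_Suc add_2_eq_Suc)
    moreover have "ln N > 0" using \<open>N > 2\<close> by simp
    ultimately show "- C * golden ^ 1 \<le> - (ln (a 1) + ln N)"
      "- C * golden ^ (1 + 1) \<le> - (ln (a (1 + 1)) + ln N)"
      by (simp_all add: C_def numeral_2_eq_2)
    show "- (ln (a (n + 1)) + ln N) + - (ln (a n) + ln N) \<le> - (ln (a (n + 2)) + ln N)"
      if "n \<ge> 1" for n
      using upper[of "n - 1"] that by (simp add: eval_nat_numeral)
  qed (use that in simp_all)
  have "ln N > 0" using \<open>N > 2\<close> by simp
  show thesis
  proof (rule that)
    show "c > 0" by fact
    show "C > 0" using \<open>ln N > 0\<close> by (simp add: C_def)
    show "c * golden ^ n \<le> ln (a n) \<and> ln (a n) \<le> C * golden ^ n" if "n \<ge> 3" for n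
      using lo[of n] up[of n] that \<open>ln N > 0\<close> by simp
  qed
qed

lemma ln_div_nat_tendsto:
  fixes f :: "nat \<Rightarrow> real"
  assumes "c > 0" "C > 0" "\<mu> > 0"
    and bounds: "\<And>n. n \<ge> k \<Longrightarrow> c * \<mu> ^ n \<le> f n \<and> f n \<le> C * \<mu> ^ n"
  shows "(\<lambda>n. ln (f n) / real n) \<longlonglongrightarrow> ln \<mu>"
proof (rule tendsto_sandwich)
  have lim: "(\<lambda>n. ln d / real n + ln \<mu>) \<longlonglongrightarrow> ln \<mu>" for d :: real
    using tendsto_add[OF lim_const_over_n tendsto_const, of "ln d" "ln \<mu>"] by simp
  show "(\<lambda>n. ln c / real n + ln \<mu>) \<longlonglongrightarrow> ln \<mu>" "(\<lambda>n. ln C / real n + ln \<mu>) \<longlonglongrightarrow> ln \<mu>"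
    by (rule lim)+
  have ln_eq: "ln (d * \<mu> ^ n) / real n = ln d / real n + ln \<mu>" if "n \<ge> 1" "d > 0" for n d
    using that \<open>\<mu> > 0\<close> by (simp add: ln_mult ln_realpow field_simps)
  have *: "ln c / real n + ln \<mu> \<le> ln (f n) / real n \<and> ln (f n) / real n \<le> ln C / real n + ln \<mu>"
    if n: "n \<ge> max 1 k" for n
  proof -
    have "0 < c * \<mu> ^ n" using assms by simp
    then have "ln (c * \<mu> ^ n) \<le> ln (f n)" "ln (f n) \<le> ln (C * \<mu> ^ n)"
      using bounds[of n] n by (auto intro!: ln_mono)
    then show ?thesis
      using n assms ln_eq[of n c] ln_eq[of n C] by (metis divide_right_mono max.boundedE of_nat_0_le_iff)
  qed
  show "\<forall>\<^sub>F n in sequentially. ln c / real n + ln \<mu> \<le> ln (f n) / real n"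
    "\<forall>\<^sub>F n in sequentially. ln (f n) / real n \<le> ln C / real n + ln \<mu>"
    unfolding eventually_sequentially using * by blast+
qed

section \<open>The polynomial orbit and its specialisations\<close>

fun vieta_poly :: "nat \<Rightarrow> int poly" where
  "vieta_poly 0 = 1"
| "vieta_poly (Suc 0) = 1"
| "vieta_poly (Suc (Suc 0)) = 1"
| "vieta_poly (Suc (Suc (Suc n))) =
     [:0, 1:] * vieta_poly (Suc (Suc n)) * vieta_poly (Suc n) - vieta_poly n"

lemma vieta_orbit_vieta_poly: "vieta_orbit [:0, 1:] vieta_poly"
  by (simp add: vieta_orbit_def eval_nat_numeral)

lemma map_poly_of_int_diff:
  "map_poly of_int (f - g) = (map_poly of_int f - map_poly of_int g :: 'a::ring_1 poly)"
  by (rule poly_eqI) (simp add: coeff_map_poly)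

lemma map_poly_of_int_mult:
  "map_poly of_int (f * g) = (map_poly of_int f * map_poly of_int g :: 'a::comm_ring_1 poly)"
  by (rule poly_eqI) (simp add: coeff_map_poly coeff_mult)

lemma poly_map_poly_of_int:
  "poly (map_poly of_int f) (of_int x :: 'a::comm_ring_1) = of_int (poly f x)"
  by (induction f) (simp_all add: map_poly_pCons)

lemma vieta_orbit_eval_real:
  "vieta_orbit x (\<lambda>n. poly (map_poly real_of_int (vieta_poly n)) x)"
  using vieta_orbit_hom[OF vieta_orbit_vieta_poly,
      of "\<lambda>f. poly (map_poly real_of_int f) x"]
  by (simp add: map_poly_of_int_diff map_poly_of_int_mult map_poly_pCons)

lemma vieta_orbit_eval_int:
  "vieta_orbit N (\<lambda>n. poly (vieta_poly n) N)"
  using vieta_orbit_hom[OF vieta_orbit_vieta_poly, of "\<lambda>f. poly f N"] by simp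

lemma vieta_orbit_eval_QN:
  "vieta_orbit QN_var (\<lambda>n. int_poly_to_QN (vieta_poly n))"
  using vieta_orbit_hom[OF vieta_orbit_vieta_poly, of int_poly_to_QN]
  by (simp add: int_poly_to_QN_def QN_var_def map_poly_of_int_diff map_poly_of_int_mult
      map_poly_pCons)

lemma int_poly_to_QN_eq_0_iff: "int_poly_to_QN f = 0 \<longleftrightarrow> f = 0"
  by (simp add: int_poly_to_QN_def map_poly_eq_0_iff)

lemma vieta_poly_eval_real_of_int:
  "poly (map_poly real_of_int (vieta_poly n)) (real_of_int N) = real_of_int (poly (vieta_poly n) N)"
  by (rule poly_map_poly_of_int)

lemma vieta_poly_eval_ge_1:
  fixes N :: int
  assumes "N \<ge> 3"
  shows "poly (vieta_poly n) N \<ge> 1"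
  using vieta_orbit_growth[OF _ vieta_orbit_eval_real, of "real_of_int N" n] assms
  by (simp add: vieta_poly_eval_real_of_int)

lemma vieta_poly_nonzero: "vieta_poly n \<noteq> 0"
  using vieta_poly_eval_ge_1[of 3 n] by auto

lemma p_sequence_QN_iff:
  "is_p_sequence_QN q \<longleftrightarrow> q = (\<lambda>n. int_poly_to_QN (vieta_poly n))"
proof
  let ?p = "\<lambda>n. int_poly_to_QN (vieta_poly n)"
  have p: "is_p_sequence_QN ?p"
    using vieta_orbit_eval_QN vieta_orbit_tau_recurrence[OF vieta_orbit_eval_QN]
    by (simp add: is_p_sequence_QN_def vieta_orbit_def)
  show "q = ?p" if "is_p_sequence_QN q"
    using p that tau_recurrence_unique[of "QN_var - 3" q ?p]
    by (simp add: is_p_sequence_QN_def int_poly_to_QN_eq_0_iff vieta_poly_nonzero)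
  show "is_p_sequence_QN q" if "q = ?p"
    using p that by simp
qed

lemma log_height_of_int:
  assumes "m \<ge> 1"
  shows "log_height (rat_of_int m) = ln (real_of_int m)"
  using assms by (simp add: log_height_def height_def)

theorem mainTheorem1:
  "\<exists>p :: nat \<Rightarrow> int poly.
     (\<forall>q. is_p_sequence_QN q \<longleftrightarrow> q = (\<lambda>n. int_poly_to_QN (p n))) \<and>
     (\<forall>N::int. N \<ge> 3 \<longrightarrow>
        (\<forall>n. let x = poly (p n) N; y = poly (p (n + 1)) N; z = poly (p (n + 2)) N; J = N - 3
             in x ^ 2 + y ^ 2 + z ^ 2 - N * x * y * z + J = 0) \<and>
        inj (\<lambda>n. (poly (p n) N, poly (p (n + 1)) N, poly (p (n + 2)) N))) \<and>
     (\<forall>N::int. N \<ge> 3 \<longrightarrow>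
        grows_exponentially (\<lambda>n. log_height (rat_of_int (poly (p n) N)))) \<and>
     (\<forall>N::real. N > 2 \<longrightarrow>
        (\<forall>n\<ge>3. poly (map_poly real_of_int (p n)) N > 1) \<and>
        (\<lambda>n. ln (ln (poly (map_poly real_of_int (p n)) N)) / real n)
          \<longlonglongrightarrow> ln ((1 + sqrt 5) / 2))"
proof (intro exI[of _ vieta_poly] conjI allI impI p_sequence_QN_iff)
  fix N :: int and n
  assume "N \<ge> 3"
  show "let x = poly (vieta_poly n) N; y = poly (vieta_poly (n + 1)) N;
          z = poly (vieta_poly (n + 2)) N; J = N - 3
        in x ^ 2 + y ^ 2 + z ^ 2 - N * x * y * z + J = 0"
    using vieta_orbit_on_surface[OF vieta_orbit_eval_int, of n N] by (simp add: Let_def)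
next
  fix N :: int
  assume "N \<ge> 3"
  then have "strict_mono (\<lambda>n. real_of_int (poly (vieta_poly (n + 2)) N))"
    using vieta_orbit_strict_mono[OF _ vieta_orbit_eval_real, of "real_of_int N"]
    by (simp add: vieta_poly_eval_real_of_int)
  then have "inj (\<lambda>n. real_of_int (poly (vieta_poly (n + 2)) N))"
    by (rule strict_mono_imp_inj_on)
  then show "inj (\<lambda>n. (poly (vieta_poly n) N, poly (vieta_poly (n + 1)) N,
      poly (vieta_poly (n + 2)) N))"
    by (simp add: inj_def)
next
  fix N :: int
  assume N: "N \<ge> 3"
  then obtain c C where "c > 0" "C > 0"
    and "\<And>n. n \<ge> 3 \<Longrightarrow> c * golden ^ n \<le> ln (real_of_int (poly (vieta_poly n) N))
      \<and> ln (real_of_int (poly (vieta_poly n) N)) \<le> C * golden ^ n"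
    using ln_vieta_orbit_bounds[OF _ vieta_orbit_eval_real, of "real_of_int N"]
    by (auto simp: vieta_poly_eval_real_of_int)
  then show "grows_exponentially (\<lambda>n. log_height (rat_of_int (poly (vieta_poly n) N)))"
    unfolding grows_exponentially_def eventually_sequentially
      log_height_of_int[OF vieta_poly_eval_ge_1[OF N]]
    using golden_gt_1 by blast
next
  fix N :: real and n :: nat
  assume "N > 2" "n \<ge> 3"
  then show "poly (map_poly real_of_int (vieta_poly n)) N > 1"
    using vieta_orbit_gt_1 vieta_orbit_eval_real by blast
next
  fix N :: real
  assume "N > 2"
  then obtain c C where "c > 0" "C > 0"
    and "\<And>n. n \<ge> 3 \<Longrightarrow> c * golden ^ n \<le> ln (poly (map_poly real_of_int (vieta_poly n)) N)
      \<and> ln (poly (map_poly real_of_int (vieta_poly n)) N) \<le> C * golden ^ n"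
    using ln_vieta_orbit_bounds[OF _ vieta_orbit_eval_real] by blast
  then show "(\<lambda>n. ln (ln (poly (map_poly real_of_int (vieta_poly n)) N)) / real n)
      \<longlonglongrightarrow> ln ((1 + sqrt 5) / 2)"
    unfolding golden_def[symmetric]
    using golden_gt_1 by (intro ln_div_nat_tendsto[of c C golden 3]) linarith+
qed

end
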